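(* In the one-dimensional one-sided discounted setting described in the context, if $\lim_{x\searrow 0}\frac{d(x)}{x^2}$ exists in $\overline{\mathbb{R}}=[-\infty,\infty]$, then $$\lim_{x\searrow 0}\frac{d(x)}{x^2}=-B_1,$$ i.e. $d(x)=-B_1x^2+o(x^2)$ as $x\searrow 0$, where $B_1\approx 2.4503$ is the unique solution to $$1=\int_0^\infty z\,e^{-B_1\frac{z^2}{2}+z}\,dz .$$
   Context: Setting. $W$ is a standard one-dimensional Brownian motion started at time $t\le 0$ in $x$, $r\ge 0$, $h:\mathbb{R}\to\mathbb{R}$ is $C^2$, and $V(t,x)=\sup_{t\le\tau\le 0}\mathbb{E}_{(t,x)}[e^{-r\tau}h(W_\tau)]$ (supremum over stopping times with values in $[t,0]$). Put $\tilde h:=rh-\frac12h''$ (continuous). The continuation set is $C=\{(t,x)\mid V(t,x)>e^{-rt}h(x)\}$, with sections $C_t$ for $t<0$; by convention its terminal section is $C_0:=\{x\mid\tilde h(x)<0\}$. Standing assumptions: the problem is one-sided, i.e. $C_t=(-\infty,b(t))$ for $t<0$, for a non-increasing function $b$; $b_\infty:=\lim_{t\to-\infty}b(t)\in(0,\infty)$; and $C_0=(-\infty,0)$. Thus $\tilde h\le 0$ on $(-\infty,0)$, $\tilde h\ge 0$ on $(0,\infty)$, $\tilde h(0)=0$. Moreover $\tilde h(x)=mx+o(x)$ as $x\to 0$ for some $m>0$. The function $d:[0,b_\infty)\to\mathbb{R}_{\le 0}$, $d(x):=\sup\{t\le 0\mid (t,x)\in C\}$, is non-increasing, with $d(0)=0$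 and $d(x)<0$ for $x>0$. The following equation holds (with finite integrals) for all $c>\sqrt{2r}$: $$-\int_{-\infty}^0e^{cy}\tilde h(y)\,dy=\int_0^{b_\infty}e^{\left(\frac{c^2}{2}-r\right)d(y)+cy}\,\tilde h(y)\,dy .$$ *)

theory Defs
  imports "HOL-Probability.Probability" "HOL-Library.Landau_Symbols"
begin

definition C2 :: "(real \<Rightarrow> real) \<Rightarrow> bool" where
  "C2 h \<longleftrightarrow> (\<forall>x. h field_differentiable at x) \<and> (\<forall>x. deriv h field_differentiable at x) \<and>
     continuous_on UNIV (deriv (deriv h))"

definition h_tilde :: "real \<Rightarrow> (real \<Rightarrow> real) \<Rightarrow> real \<Rightarrow> real" where
  "h_tilde r h x = r * h x - deriv (deriv h) x / 2"

text \<open>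
  Under the measure \<open>M\<close>, the process \<open>W\<close> restricted to the time interval \<open>[t, 0]\<close> is a standard
  Brownian motion with respect to the filtration \<open>F\<close>, started at time \<open>t\<close> in \<open>x\<close>. The filtration
  may be larger than the one generated by \<open>W\<close>. Times are real numbers so that the filtrations and
  stopping times of the library apply; only times in \<open>[t, 0]\<close> matter.
\<close>

definition brownian_motion_from ::
  "'a measure \<Rightarrow> (real \<Rightarrow> 'a measure) \<Rightarrow> (real \<Rightarrow> 'a \<Rightarrow> real) \<Rightarrow> real \<Rightarrow> real \<Rightarrow> bool" where
  "brownian_motion_from M F W t x \<longleftrightarrow>
     prob_space M \<and> filtration (space M) F \<and> (\<forall>s. sets (F s) \<subseteq> sets M) \<and>
     (\<forall>s\<in>{t..0}. W s \<in> borel_measurable (F s)) \<and>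
     (AE \<omega> in M. W t \<omega> = x) \<and>
     (\<forall>\<omega>\<in>space M. continuous_on {t..0} (\<lambda>s. W s \<omega>)) \<and>
     (\<forall>u s. t \<le> u \<and> u < s \<and> s \<le> 0 \<longrightarrow>
        distributed M lborel (\<lambda>\<omega>. W s \<omega> - W u \<omega>) (normal_density 0 (sqrt (s - u))) \<and>
        prob_space.indep_set M (sets (F u))
          {(\<lambda>\<omega>. W s \<omega> - W u \<omega>) -` A \<inter> space M | A. A \<in> sets borel})"

text \<open>
  No growth condition on the gain function is assumed, so expectations are taken in the extended
  reals whenever the positive or the negative part has finite expectation. The Bochner integral would
  instead give a non-integrable payoff the value 0.
\<close>

definition has_expectation :: "'a measure \<Rightarrow> ('a \<Rightarrow> real) \<Rightarrow> bool" where
  "has_expectation M X \<longleftrightarrow>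
     (\<integral>\<^sup>+ \<omega>. ennreal (X \<omega>) \<partial>M) < \<infinity> \<or> (\<integral>\<^sup>+ \<omega>. ennreal (- X \<omega>) \<partial>M) < \<infinity>"

definition ext_expectation :: "'a measure \<Rightarrow> ('a \<Rightarrow> real) \<Rightarrow> ereal" where
  "ext_expectation M X =
     enn2ereal (\<integral>\<^sup>+ \<omega>. ennreal (X \<omega>) \<partial>M) - enn2ereal (\<integral>\<^sup>+ \<omega>. ennreal (- X \<omega>) \<partial>M)"

definition payoff ::
  "(real \<Rightarrow> 'a \<Rightarrow> real) \<Rightarrow> real \<Rightarrow> (real \<Rightarrow> real) \<Rightarrow> ('a \<Rightarrow> real) \<Rightarrow> 'a \<Rightarrow> real" where
  "payoff W r h \<tau> \<omega> = exp (- r * \<tau> \<omega>) * h (W (\<tau> \<omega>) \<omega>)"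

definition value_fun ::
  "(real \<Rightarrow> real \<Rightarrow> 'a measure) \<Rightarrow> (real \<Rightarrow> 'a measure) \<Rightarrow> (real \<Rightarrow> 'a \<Rightarrow> real) \<Rightarrow>
     real \<Rightarrow> (real \<Rightarrow> real) \<Rightarrow> real \<Rightarrow> real \<Rightarrow> ereal" where
  "value_fun P F W r h t x =
     (SUP \<tau> \<in> {\<tau>. stopping_time F \<tau> \<and> (\<forall>\<omega>\<in>space (P t x). \<tau> \<omega> \<in> {t..0}) \<and>
                  has_expectation (P t x) (payoff W r h \<tau>)}.
        ext_expectation (P t x) (payoff W r h \<tau>))"

text \<open>
  At time 0 the value function equals the gain function, so there the section of the continuation
  set is fixed by convention.
\<close>

definition continuation_set ::
  "(real \<Rightarrow> real \<Rightarrow> 'a measure) \<Rightarrow> (real \<Rightarrow> 'a measure) \<Rightarrow> (real \<Rightarrow> 'a \<Rightarrow> real) \<Rightarrow>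
     real \<Rightarrow> (real \<Rightarrow> real) \<Rightarrow> (real \<times> real) set" where
  "continuation_set P F W r h =
     {(t, x). t < 0 \<and> value_fun P F W r h t x > ereal (exp (- r * t) * h x)} \<union>
     {(0, x) | x. h_tilde r h x < 0}"

definition exit_time :: "(real \<times> real) set \<Rightarrow> real \<Rightarrow> real" where
  "exit_time C x = Sup {t. t \<le> 0 \<and> (t, x) \<in> C}"

definition B1_equation :: "real \<Rightarrow> bool" where
  "B1_equation B \<longleftrightarrow>
     set_integrable lborel {0<..} (\<lambda>z. z * exp (- B * (z\<^sup>2 / 2) + z)) \<and>
     1 = (LBINT z:{0<..}. z * exp (- B * (z\<^sup>2 / 2) + z))"

end

theory Submission
  imports Defs "HOL-Real_Asymp.Real_Asymp"
begin

text \<open>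
  The integral equation holds for all large \<open>c\<close>, and letting \<open>c \<rightarrow> \<infinity>\<close> makes it see only the
  behaviour of \<open>d\<close> and \<open>h_tilde\<close> at \<open>0\<close>. Multiply both sides by \<open>c\<^sup>2\<close> and substitute \<open>y = z / c\<close>.
  On the left \<open>- h_tilde y\<close> may be replaced by \<open>- m y\<close>, so that side tends to
  \<open>m \<cdot> \<integral>\<^sub>0\<^sup>\<infinity> z e\<^sup>-\<^sup>z dz = m\<close> (\<open>laplace_transform_linear_at_zero\<close>). On the right \<open>h_tilde y\<close> may be
  replaced by \<open>m y\<close>, and a bound \<open>d y \<le> - \<beta> y\<^sup>2\<close> or \<open>d y \<ge> - \<beta> y\<^sup>2\<close> near \<open>0\<close> bounds the exponent by
  \<open>- \<beta> z\<^sup>2 / 2 + z\<close>, from above or from below, up to terms that vanish. The limit is therefore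
  compared with \<open>m \<cdot> J \<beta>\<close>, where \<open>J \<beta> = \<integral>\<^sub>0\<^sup>\<infinity> z exp (- \<beta> z\<^sup>2 / 2 + z) dz\<close> is called \<open>weight_mass\<close>
  below (\<open>boundary_integral_le\<close>, \<open>boundary_integral_ge\<close>). So \<open>d y \<le> - \<beta> y\<^sup>2\<close> near \<open>0\<close> forces
  \<open>J \<beta> \<ge> 1\<close>, and \<open>d y \<ge> - \<beta> y\<^sup>2\<close> near \<open>0\<close> forces \<open>J \<beta> \<le> 1\<close>.

  Since \<open>J\<close> is strictly decreasing and \<open>J B1 = 1\<close>, a limit \<open>L\<close> of \<open>d y / y\<^sup>2\<close> with \<open>L < - B1\<close> would
  give some \<open>\<beta> > B1\<close> of the first kind, and \<open>L > - B1\<close> some \<open>\<beta> < B1\<close> of the second kind; both are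
  contradictory. This also excludes the infinite values of \<open>L\<close>.

  Existence and the numerical value of \<open>B1\<close> come from the intermediate value theorem between
  \<open>2.45025\<close> and \<open>2.45035\<close>. Integration by parts and completing the square express \<open>J B\<close> through
  \<open>\<pi>\<close>, an exponential and the integral of a Gaussian over \<open>[0, 1/B]\<close>; alternating Taylor
  polynomials enclose the last two.
\<close>

section \<open>The integral that determines the constant\<close>

definition weight :: "real \<Rightarrow> real \<Rightarrow> real" where
  "weight B z = z * exp (- B * (z\<^sup>2 / 2) + z)"

definition weight_mass :: "real \<Rightarrow> real" where
  "weight_mass B = (LBINT z:{0<..}. weight B z)"

lemma B1_equation_iff:
  "B1_equation B \<longleftrightarrow> set_integrable lborel {0<..} (weight B) \<and> weight_mass B = 1"
  unfolding B1_equation_def weight_mass_def weight_def[abs_def] by auto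

lemma weight_borel_measurable [measurable]: "weight B \<in> borel_measurable borel"
  unfolding weight_def[abs_def] by measurable

lemma has_bochner_integral_x_exp_minus:
  "has_bochner_integral lborel (\<lambda>z::real. indicator {0<..} z *\<^sub>R (z * exp (- z))) 1"
proof (rule has_bochner_integral_nn_integral)
  have "(\<integral>\<^sup>+ z. ennreal (indicator {0<..} z *\<^sub>R (z * exp (- z))) \<partial>lborel)
      = (\<integral>\<^sup>+ z. ennreal (z ^ 1 * exp (- z)) * indicator {0..} z \<partial>lborel)"
    by (intro nn_integral_cong) (auto split: split_indicator)
  then show "(\<integral>\<^sup>+ z. ennreal (indicator {0<..} z *\<^sub>R (z * exp (- z))) \<partial>lborel) = ennreal 1"
    by (subst (asm) nn_intergal_power_times_exp_Ici) simp
qed (auto split: split_indicator)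

lemma x_exp_minus_integrable: "set_integrable lborel {0<..} (\<lambda>z::real. z * exp (- z))"
  and x_exp_minus_integral: "(LBINT z:{0<..}. z * exp (- z)) = (1::real)"
  using has_bochner_integral_x_exp_minus
  unfolding set_integrable_def set_lebesgue_integral_def has_bochner_integral_iff by auto

text \<open>
  Trading the Gaussian for \<open>exp (- z)\<close> at the price of a constant makes all later integrability
  questions questions about \<open>z * exp (- z)\<close>. The difference of the exponents is a square.
\<close>

lemma exp_gauss_le:
  fixes B z :: real
  assumes "B > 0"
  shows "exp (- B * (z\<^sup>2 / 2) + z) \<le> exp (2 / B) * exp (- z)"
proof -
  have "2 / B - 2 * z + B * (z\<^sup>2 / 2) = B / 2 * (z - 2 / B)\<^sup>2"
    using assms by (simp add: power2_eq_square field_simps)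
  also have "\<dots> \<ge> 0" using assms by simp
  finally show ?thesis by (simp add: exp_add [symmetric])
qed

lemma weight_le:
  assumes "B > 0" "z > 0"
  shows "weight B z \<le> exp (2 / B) * (z * exp (- z))"
  using mult_left_mono[OF exp_gauss_le[OF assms(1), of z], of z] assms(2)
  by (simp add: weight_def mult_ac)

lemma weight_pos: "z > 0 \<Longrightarrow> weight B z > 0"
  by (simp add: weight_def)

lemma weight_antimono: "z \<ge> 0 \<Longrightarrow> B \<le> B' \<Longrightarrow> weight B' z \<le> weight B z"
  by (auto simp: weight_def intro!: mult_left_mono mult_right_mono)

lemma weight_strict_antimono: "z > 0 \<Longrightarrow> B < B' \<Longrightarrow> weight B' z < weight B z"
  by (simp add: weight_def)

lemma weight_integrable:
  assumes "B > 0"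
  shows "set_integrable lborel {0<..} (weight B)"
  by (rule set_integrable_bound[OF set_integrable_mult_right[of "exp (2 / B)", OF x_exp_minus_integrable]])
     (use assms weight_le[of B] in \<open>auto simp: set_borel_measurable_def abs_of_pos weight_pos\<close>)

text \<open>
  The hypothesis is integrability at the smaller parameter because \<^const>\<open>B1_equation\<close> provides it:
  uniqueness of the solution among all reals, the non-positive ones included, is then immediate.
\<close>

lemma weight_mass_strict_antimono:
  assumes B: "set_integrable lborel {0<..} (weight B)" and "B < B'"
  shows "weight_mass B' < weight_mass B"
proof -
  have B': "set_integrable lborel {0<..} (weight B')"
    by (rule set_integrable_bound[OF B])
       (use weight_strict_antimono[OF _ \<open>B < B'\<close>] in
         \<open>auto simp: set_borel_measurable_def abs_of_pos weight_pos less_imp_le\<close>)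
  let ?g = "\<lambda>z. indicator {0<..} z *\<^sub>R (weight B z - weight B' z)"
  have g_nonneg: "?g z \<ge> 0" for z
    using weight_strict_antimono[OF _ \<open>B < B'\<close>, of z] by (auto split: split_indicator)
  have g_int: "integrable lborel ?g"
    using set_integral_diff(1)[OF B B'] by (simp add: set_integrable_def)
  have g_eq: "integral\<^sup>L lborel ?g = weight_mass B - weight_mass B'"
    using set_integral_diff(2)[OF B B'] by (simp add: set_lebesgue_integral_def weight_mass_def)
  have "integral\<^sup>L lborel ?g \<noteq> 0"
  proof
    assume "integral\<^sup>L lborel ?g = 0"
    then have "AE z in lborel. ?g z = 0"
      using integral_nonneg_eq_0_iff_AE[OF g_int] g_nonneg by blast
    then have "AE z in lborel. z \<notin> {0<..<1::real}"
      by eventually_elim (use weight_strict_antimono[OF _ \<open>B < B'\<close>] in \<open>force split: split_indicator_asm\<close>)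
    then have "{0<..<1::real} \<in> null_sets lborel"
      by (subst AE_iff_null_sets) auto
    then show False by (simp add: null_sets_def)
  qed
  moreover have "integral\<^sup>L lborel ?g \<ge> 0"
    by (rule Bochner_Integration.integral_nonneg) (rule g_nonneg)
  ultimately show ?thesis using g_eq by linarith
qed

lemma weight_mass_continuous:
  assumes "0 < a"
  shows "continuous_on {a..b} weight_mass"
  unfolding continuous_on_sequentially comp_def
proof (intro allI ballI impI, elim conjE)
  fix X :: "nat \<Rightarrow> real" and B
  assume X: "\<forall>n. X n \<in> {a..b}" and lim: "X \<longlonglongrightarrow> B"
  show "(\<lambda>n. weight_mass (X n)) \<longlonglongrightarrow> weight_mass B"
    unfolding weight_mass_def set_lebesgue_integral_def
  proof (rule integral_dominated_convergence)
    \<comment> \<open>The weight decreases in its parameter, so its value at the left endpoint dominates.\<close>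
    show "integrable lborel (\<lambda>z. indicator {0<..} z *\<^sub>R weight a z)"
      using weight_integrable[OF assms] by (simp add: set_integrable_def)
    show "AE z in lborel. (\<lambda>n. indicat_real {0<..} z *\<^sub>R weight (X n) z)
        \<longlonglongrightarrow> indicat_real {0<..} z *\<^sub>R weight B z"
      unfolding weight_def by (intro AE_I2 tendsto_intros lim)
    show "AE z in lborel. norm (indicat_real {0<..} z *\<^sub>R weight (X n) z)
        \<le> indicator {0<..} z *\<^sub>R weight a z" for n
      using weight_antimono[of z a "X n" for z] X
      by (intro AE_I2) (auto split: split_indicator simp: abs_of_pos weight_pos)
  qed auto
qed

section \<open>Integrals that concentrate at the origin\<close>

text \<open>
  The substitution \<open>z = c y\<close> turns the bounded interval into \<open>(0, c \<delta>)\<close>, which exhausts the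
  half-line.
\<close>

lemma scaled_integral_tendsto:
  fixes \<phi> :: "real \<Rightarrow> real"
  assumes "set_integrable lborel {0<..} \<phi>" and "\<delta> > 0"
  shows "((\<lambda>c. c * (LBINT y:{0<..<\<delta>}. \<phi> (c * y))) \<longlongrightarrow> (LBINT z:{0<..}. \<phi> z)) at_top"
proof -
  let ?f = "\<lambda>z. indicator {0<..} z *\<^sub>R \<phi> z"
  have int: "integrable lborel ?f"
    using assms(1) by (simp add: set_integrable_def)
  have *: "c * (LBINT y:{0<..<\<delta>}. \<phi> (c * y)) = (LBINT z. indicator {..<c * \<delta>} z *\<^sub>R ?f z)"
    if "c > 0" for c
    unfolding set_lebesgue_integral_def
    using that \<open>\<delta> > 0\<close>
    by (subst (2) lborel_integral_real_affine[where c = c and t = 0])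
       (auto intro!: Bochner_Integration.integral_cong simp: zero_less_mult_iff split: split_indicator)
  have "((\<lambda>c. LBINT z. indicator {..<c * \<delta>} z *\<^sub>R ?f z) \<longlongrightarrow> (LBINT z. ?f z)) at_top"
  proof (rule integral_dominated_convergence_at_top)
    show "integrable lborel (\<lambda>z. norm (?f z))" using int by (rule integrable_norm)
    show "\<forall>\<^sub>F c in at_top. AE z in lborel. norm (indicator {..<c * \<delta>} z *\<^sub>R ?f z) \<le> norm (?f z)"
      by (auto split: split_indicator)
    show "AE z in lborel. ((\<lambda>c. indicator {..<c * \<delta>} z *\<^sub>R ?f z) \<longlongrightarrow> ?f z) at_top"
    proof (rule AE_I2)
      fix z :: real
      have "\<forall>\<^sub>F c in at_top. c > z / \<delta>" by (rule eventually_gt_at_top)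
      then have "\<forall>\<^sub>F c in at_top. indicator {..<c * \<delta>} z *\<^sub>R ?f z = ?f z"
        by eventually_elim (use \<open>\<delta> > 0\<close> in \<open>auto simp: field_simps split: split_indicator\<close>)
      then show "((\<lambda>c. indicator {..<c * \<delta>} z *\<^sub>R ?f z) \<longlongrightarrow> ?f z) at_top"
        by (rule tendsto_eventually)
    qed
  qed (use int borel_measurable_integrable[OF int] in auto)
  then show ?thesis
    unfolding set_lebesgue_integral_def
    by (rule Lim_transform_eventually)
       (use eventually_gt_at_top[of 0] in \<open>eventually_elim, use * in \<open>simp add: set_lebesgue_integral_def\<close>\<close>)
qed

lemma scaled_integrable:
  fixes \<phi> :: "real \<Rightarrow> real"
  assumes "set_integrable lborel {0<..} \<phi>" and "c > 0"
  shows "set_integrable lborel {0<..<\<delta>} (\<lambda>y. \<phi> (c * y))"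
proof -
  have "integrable lborel (\<lambda>y. indicator {0<..} (0 + c * y) *\<^sub>R \<phi> (0 + c * y))"
    using assms by (intro lborel_integrable_real_affine) (auto simp: set_integrable_def)
  then have "set_integrable lborel {0<..} (\<lambda>y. \<phi> (c * y))"
    unfolding set_integrable_def
    by (rule Bochner_Integration.integrable_cong[THEN iffD1, rotated 2])
       (use \<open>c > 0\<close> in \<open>auto split: split_indicator simp: zero_less_mult_iff\<close>)
  then show ?thesis by (rule set_integrable_subset) auto
qed

text \<open>
  A Laplace-type principle. Near the origin \<open>c * K c\<close> is at most the rescaled profile \<open>\<phi>\<close>, whose
  contribution converges by the preceding lemmas; away from the origin the kernel is at most
  \<open>\<rho> c\<close> times one fixed integrable kernel, and \<open>\<rho>\<close> beats the factor \<open>c\<^sup>2\<close>. As neither \<open>K\<close> nor \<open>\<phi>\<close>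
  has a sign, lower bounds follow by applying it to \<open>- K\<close> and \<open>- \<phi>\<close>.
\<close>

lemma eventually_scaled_integral_le:
  fixes K :: "real \<Rightarrow> real \<Rightarrow> real"
  assumes S: "S \<in> sets lborel" "{0<..<\<delta>} \<subseteq> S" and "\<delta> > 0"
    and int: "\<And>c. c > p \<Longrightarrow> set_integrable lborel S (K c)"
    and \<phi>: "set_integrable lborel {0<..} \<phi>"
    and loc: "\<And>c y. c > p \<Longrightarrow> 0 < y \<Longrightarrow> y < \<delta> \<Longrightarrow> c * K c y \<le> \<phi> (c * y)"
    and q: "q > p"
    and tail: "\<And>c y. c \<ge> q \<Longrightarrow> y \<in> S - {0<..<\<delta>} \<Longrightarrow> \<bar>K c y\<bar> \<le> \<rho> c * \<bar>K q y\<bar>"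
    and \<rho>: "((\<lambda>c. c\<^sup>2 * \<rho> c) \<longlongrightarrow> 0) at_top"
    and e: "e > 0"
  shows "\<forall>\<^sub>F c in at_top. c\<^sup>2 * (LBINT y:S. K c y) \<le> (LBINT z:{0<..}. \<phi> z) + e"
proof -
  let ?T = "S - {0<..<\<delta>}"
  define A where "A = (LBINT y:?T. \<bar>K q y\<bar>)"
  have "((\<lambda>c. c * (LBINT y:{0<..<\<delta>}. \<phi> (c * y)) + c\<^sup>2 * \<rho> c * A)
      \<longlongrightarrow> (LBINT z:{0<..}. \<phi> z) + 0 * A) at_top"
    by (intro tendsto_intros scaled_integral_tendsto[OF \<phi> \<open>\<delta> > 0\<close>] \<rho>)
  then have "\<forall>\<^sub>F c in at_top. c * (LBINT y:{0<..<\<delta>}. \<phi> (c * y)) + c\<^sup>2 * \<rho> c * A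
      < (LBINT z:{0<..}. \<phi> z) + e"
    by (rule order_tendstoD) (use e in simp)
  then show ?thesis
    using eventually_ge_at_top[of q] eventually_gt_at_top[of 0]
  proof eventually_elim
    case (elim c)
    have c: "c > p" using elim q by simp
    have loc_int: "set_integrable lborel {0<..<\<delta>} (K c)"
      by (rule set_integrable_subset[OF int[OF c]]) (use S in auto)
    have tail_int: "set_integrable lborel ?T (K c')" if "c' > p" for c'
      by (rule set_integrable_subset[OF int[OF that]]) (use S in auto)
    have "(LBINT y:S. K c y) = (LBINT y:{0<..<\<delta>} \<union> ?T. K c y)"
      using S by (simp add: Un_absorb1)
    also have "\<dots> = (LBINT y:{0<..<\<delta>}. K c y) + (LBINT y:?T. K c y)"
      by (rule set_integral_Un[OF _ loc_int tail_int[OF c]]) auto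
    finally have split: "c\<^sup>2 * (LBINT y:S. K c y)
        = c * (LBINT y:{0<..<\<delta>}. c * K c y) + c\<^sup>2 * (LBINT y:?T. K c y)"
      by (simp add: distrib_left power2_eq_square)
    have "(LBINT y:{0<..<\<delta>}. c * K c y) \<le> (LBINT y:{0<..<\<delta>}. \<phi> (c * y))"
      by (intro set_integral_mono scaled_integrable[OF \<phi>] set_integrable_mult_right loc_int)
         (use elim c loc in auto)
    moreover have "(LBINT y:?T. K c y) \<le> (LBINT y:?T. \<rho> c * \<bar>K q y\<bar>)"
      by (intro set_integral_mono tail_int set_integrable_mult_right set_integrable_abs c q)
         (use tail elim in force)
    then have "(LBINT y:?T. K c y) \<le> \<rho> c * A" by (simp add: A_def)
    ultimately have "c\<^sup>2 * (LBINT y:S. K c y)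
        \<le> c * (LBINT y:{0<..<\<delta>}. \<phi> (c * y)) + c\<^sup>2 * (\<rho> c * A)"
      unfolding split using elim by (intro add_mono mult_left_mono) auto
    then show ?case using elim by (simp add: mult_ac)
  qed
qed

lemma laplace_transform_linear_at_zero_le:
  fixes g :: "real \<Rightarrow> real"
  assumes int: "\<And>c. c > c0 \<Longrightarrow> set_integrable lborel {0<..} (\<lambda>y. exp (- c * y) * g y)"
    and "c0 \<ge> 0"
    and g: "\<And>\<epsilon>. \<epsilon> > 0 \<Longrightarrow> \<forall>\<^sub>F y in at_right 0. g y \<le> (m + \<epsilon>) * y"
    and "e > 0"
  shows "\<forall>\<^sub>F c in at_top. c\<^sup>2 * (LBINT y:{0<..}. exp (- c * y) * g y) \<le> m + e"
proof -
  obtain \<delta> where \<delta>: "\<delta> > 0" "\<And>y. 0 < y \<Longrightarrow> y < \<delta> \<Longrightarrow> g y \<le> (m + e / 2) * y"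
    using g[of "e / 2"] \<open>e > 0\<close> by (auto simp: eventually_at_right_field)
  define c1 where "c1 = c0 + 1"
  have "\<forall>\<^sub>F c in at_top. c\<^sup>2 * (LBINT y:{0<..}. exp (- c * y) * g y)
      \<le> (LBINT z:{0<..}. (m + e / 2) * (z * exp (- z))) + e / 2"
  proof (rule eventually_scaled_integral_le[where \<delta> = \<delta> and q = c1
        and \<rho> = "\<lambda>c. exp (- (c - c1) * \<delta>)"])
    show "set_integrable lborel {0<..} (\<lambda>z::real. (m + e / 2) * (z * exp (- z)))"
      by (intro set_integrable_mult_right x_exp_minus_integrable)
    show "c * (exp (- c * y) * g y) \<le> (m + e / 2) * (c * y * exp (- (c * y)))"
      if "c > c0" "0 < y" "y < \<delta>" for c y
      using mult_left_mono[OF \<delta>(2)[OF that(2,3)], of "c * exp (- c * y)"] that \<open>c0 \<ge> 0\<close>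
      by (simp add: mult_ac)
    show "\<bar>exp (- c * y) * g y\<bar> \<le> exp (- (c - c1) * \<delta>) * \<bar>exp (- c1 * y) * g y\<bar>"
      if "c \<ge> c1" "y \<in> {0<..} - {0<..<\<delta>}" for c y
    proof -
      have "(c - c1) * \<delta> \<le> (c - c1) * y" using that by (intro mult_left_mono) auto
      then have "exp (- c * y) \<le> exp (- (c - c1) * \<delta>) * exp (- c1 * y)"
        by (simp add: exp_add [symmetric] algebra_simps)
      from mult_right_mono[OF this, of "\<bar>g y\<bar>"] show ?thesis by (simp add: abs_mult)
    qed
    show "((\<lambda>c. c\<^sup>2 * exp (- (c - c1) * \<delta>)) \<longlongrightarrow> 0) at_top"
      using \<open>\<delta> > 0\<close> by real_asymp
  qed (use \<delta> int \<open>e > 0\<close> in \<open>auto simp: c1_def\<close>)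
  then show ?thesis by (simp add: x_exp_minus_integral add_ac)
qed

text \<open>
  The Laplace transform at \<open>c\<close> of a function that behaves like \<open>m y\<close> at \<open>0\<close> is asymptotic to \<open>m / c\<^sup>2\<close>,
  because \<open>\<integral>\<^sub>0\<^sup>\<infinity> z e\<^sup>-\<^sup>z dz = 1\<close>.
\<close>

lemma laplace_transform_linear_at_zero:
  fixes g :: "real \<Rightarrow> real"
  assumes int: "\<And>c. c > c0 \<Longrightarrow> set_integrable lborel {0<..} (\<lambda>y. exp (- c * y) * g y)"
    and "c0 \<ge> 0"
    and g: "\<And>\<epsilon>. \<epsilon> > 0 \<Longrightarrow> \<forall>\<^sub>F y in at_right 0. \<bar>g y - m * y\<bar> \<le> \<epsilon> * y"
  shows "((\<lambda>c. c\<^sup>2 * (LBINT y:{0<..}. exp (- c * y) * g y)) \<longlongrightarrow> m) at_top"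
proof (rule tendstoI)
  fix e :: real assume "e > 0"
  have "\<forall>\<^sub>F c in at_top. c\<^sup>2 * (LBINT y:{0<..}. exp (- c * y) * g y) \<le> m + e / 2"
  proof (rule laplace_transform_linear_at_zero_le[OF int \<open>c0 \<ge> 0\<close>])
    show "\<forall>\<^sub>F y in at_right 0. g y \<le> (m + \<epsilon>) * y" if "\<epsilon> > 0" for \<epsilon>
      using g[OF that] by eventually_elim (simp add: algebra_simps abs_le_iff)
  qed (use \<open>e > 0\<close> in auto)
  moreover have "\<forall>\<^sub>F c in at_top. c\<^sup>2 * (LBINT y:{0<..}. exp (- c * y) * (- g y)) \<le> - m + e / 2"
  proof (rule laplace_transform_linear_at_zero_le[OF _ \<open>c0 \<ge> 0\<close>])
    show "\<forall>\<^sub>F y in at_right 0. - g y \<le> (- m + \<epsilon>) * y" if "\<epsilon> > 0" for \<epsilon>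
      using g[OF that] by eventually_elim (simp add: algebra_simps abs_le_iff)
    show "set_integrable lborel {0<..} (\<lambda>y. exp (- c * y) * (- g y))" if "c > c0" for c
      using set_integrable_mult_right[OF int[OF that], of "- 1"] by simp
  qed (use \<open>e > 0\<close> in auto)
  then have "\<forall>\<^sub>F c in at_top. - (c\<^sup>2 * (LBINT y:{0<..}. exp (- c * y) * g y)) \<le> - m + e / 2"
    by (simp add: set_lebesgue_integral_def)
  ultimately show "\<forall>\<^sub>F c in at_top. dist (c\<^sup>2 * (LBINT y:{0<..}. exp (- c * y) * g y)) m < e"
    by eventually_elim (use \<open>e > 0\<close> in \<open>simp add: dist_real_def abs_less_iff\<close>)
qed

text \<open>
  Away from the origin the monotone \<open>d\<close> stays below \<open>d \<delta>\<close>. If \<open>d \<delta> < 0\<close>, its quadratic coefficient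
  \<open>c\<^sup>2 / 2\<close> outweighs the growth of \<open>exp (c y)\<close> on the bounded interval.
\<close>

lemma boundary_kernel_decay:
  fixes d :: "real \<Rightarrow> real"
  assumes d_mono: "antimono_on {0<..<b} d"
    and \<delta>: "0 < \<delta>" "\<delta> < b"
    and y: "y \<in> {0<..<b} - {0<..<\<delta>}" and c: "c \<ge> c1" and "c1 > 0"
  shows "exp ((c\<^sup>2 / 2 - r) * d y + c * y)
     \<le> exp ((c\<^sup>2 - c1\<^sup>2) / 2 * d \<delta> + (c - c1) * b) * exp ((c1\<^sup>2 / 2 - r) * d y + c1 * y)"
proof -
  have "d y \<le> d \<delta>" using d_mono y \<delta> by (intro monotone_onD[OF d_mono]) auto
  moreover have "c1\<^sup>2 \<le> c\<^sup>2" using c \<open>c1 > 0\<close> by simp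
  ultimately have "(c\<^sup>2 - c1\<^sup>2) / 2 * d y \<le> (c\<^sup>2 - c1\<^sup>2) / 2 * d \<delta>"
    by (intro mult_left_mono) auto
  moreover have "(c - c1) * y \<le> (c - c1) * b" using y c by (intro mult_left_mono) auto
  ultimately show ?thesis by (simp add: exp_add [symmetric] algebra_simps diff_divide_distrib)
qed

lemma boundary_kernel_decay_rate:
  fixes D b c1 :: real
  assumes "D < 0"
  shows "((\<lambda>c. c\<^sup>2 * exp ((c\<^sup>2 - c1\<^sup>2) / 2 * D + (c - c1) * b)) \<longlongrightarrow> 0) at_top"
  using assms by real_asymp

text \<open>
  With \<open>d y \<le> - \<beta> y\<^sup>2\<close> and \<open>z = c y\<close> the exponent is at most
  \<open>- \<beta> z\<^sup>2 / 2 + z + r \<beta> y\<^sup>2\<close>; on a small interval the discounting term \<open>r \<beta> y\<^sup>2\<close> and the error in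
  \<open>g y \<approx> m y\<close> change the result only by a
  factor arbitrarily close to \<open>1\<close>.
\<close>

lemma boundary_integral_le:
  fixes g d :: "real \<Rightarrow> real"
  assumes int: "\<And>c. c > sqrt (2 * r) \<Longrightarrow>
      set_integrable lborel {0<..<b} (\<lambda>y. exp ((c\<^sup>2 / 2 - r) * d y + c * y) * g y)"
    and r: "r \<ge> 0" and b: "b > 0" and m: "m > 0" and \<beta>: "\<beta> > 0"
    and g: "\<And>\<epsilon>. \<epsilon> > 0 \<Longrightarrow> \<forall>\<^sub>F y in at_right 0. \<bar>g y - m * y\<bar> \<le> \<epsilon> * y"
    and d_mono: "antimono_on {0<..<b} d" and d_neg: "\<And>y. 0 < y \<Longrightarrow> y < b \<Longrightarrow> d y < 0"
    and d: "\<forall>\<^sub>F y in at_right 0. d y \<le> - \<beta> * y\<^sup>2"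
    and "e > 0"
  shows "\<forall>\<^sub>F c in at_top. c\<^sup>2 * (LBINT y:{0<..<b}. exp ((c\<^sup>2 / 2 - r) * d y + c * y) * g y)
     \<le> m * weight_mass \<beta> + e"
proof -
  \<comment> \<open>One parameter \<open>\<epsilon>\<close> bounds the relative error of \<open>g\<close> and the length of the interval.\<close>
  have "((\<lambda>\<epsilon>. (m + \<epsilon>) * exp (r * \<beta> * \<epsilon>\<^sup>2) * weight_mass \<beta>)
      \<longlongrightarrow> (m + 0) * exp (r * \<beta> * 0\<^sup>2) * weight_mass \<beta>) (at_right 0)"
    by (intro tendsto_intros)
  then have "\<forall>\<^sub>F \<epsilon> in at_right 0. (m + \<epsilon>) * exp (r * \<beta> * \<epsilon>\<^sup>2) * weight_mass \<beta> < m * weight_mass \<beta> + e / 2"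
    by (rule order_tendstoD) (use \<open>e > 0\<close> in simp)
  then have "\<forall>\<^sub>F \<epsilon> in at_right 0. \<epsilon> > 0 \<and> (m + \<epsilon>) * exp (r * \<beta> * \<epsilon>\<^sup>2) * weight_mass \<beta> < m * weight_mass \<beta> + e / 2"
    by (intro eventually_conj eventually_at_right_less)
  then obtain \<epsilon> where \<epsilon>: "\<epsilon> > 0"
    "(m + \<epsilon>) * exp (r * \<beta> * \<epsilon>\<^sup>2) * weight_mass \<beta> < m * weight_mass \<beta> + e / 2"
    using eventually_happens'[OF trivial_limit_at_right_real] by blast
  obtain \<eta> where \<eta>: "\<eta> > 0"
    "\<And>y. 0 < y \<Longrightarrow> y < \<eta> \<Longrightarrow> \<bar>g y - m * y\<bar> \<le> \<epsilon> * y \<and> d y \<le> - \<beta> * y\<^sup>2"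
    using eventually_conj[OF g[OF \<epsilon>(1)] d] by (auto simp: eventually_at_right_field)
  define \<delta> where "\<delta> = Min {\<eta>, \<epsilon>, b / 2}"
  have \<delta>: "0 < \<delta>" "\<delta> \<le> \<eta>" "\<delta> \<le> \<epsilon>" "\<delta> < b"
    using \<eta> \<epsilon> b by (auto simp: \<delta>_def)
  define c1 where "c1 = sqrt (2 * r) + 1"
  have c1: "c1 > sqrt (2 * r)" "c1 > 0" using r by (auto simp: c1_def add_nonneg_pos)
  define A where "A = (m + \<epsilon>) * exp (r * \<beta> * \<epsilon>\<^sup>2)"
  have "\<forall>\<^sub>F c in at_top. c\<^sup>2 * (LBINT y:{0<..<b}. exp ((c\<^sup>2 / 2 - r) * d y + c * y) * g y)
      \<le> (LBINT z:{0<..}. A * weight \<beta> z) + e / 2"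
  proof (rule eventually_scaled_integral_le[where \<delta> = \<delta> and q = c1 and p = "sqrt (2 * r)"
        and \<rho> = "\<lambda>c. exp ((c\<^sup>2 - c1\<^sup>2) / 2 * d \<delta> + (c - c1) * b)"])
    show "set_integrable lborel {0<..} (\<lambda>z. A * weight \<beta> z)"
      by (intro set_integrable_mult_right weight_integrable \<beta>)
    show "c * (exp ((c\<^sup>2 / 2 - r) * d y + c * y) * g y) \<le> A * weight \<beta> (c * y)"
      if c: "c > sqrt (2 * r)" and y: "0 < y" "y < \<delta>" for c y
    proof -
      have "c \<ge> 0" using c r real_sqrt_ge_zero[of "2 * r"] by linarith
      have "2 * r \<le> c\<^sup>2" using c r \<open>c \<ge> 0\<close> real_le_lsqrt by (intro sqrt_le_D) simp
      then have "(c\<^sup>2 / 2 - r) * d y \<le> (c\<^sup>2 / 2 - r) * (- \<beta> * y\<^sup>2)"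
        using \<eta>(2)[of y] y \<delta> by (intro mult_left_mono) auto
      also have "\<dots> \<le> - \<beta> * ((c * y)\<^sup>2 / 2) + r * \<beta> * \<epsilon>\<^sup>2"
      proof -
        have "r * \<beta> * y\<^sup>2 \<le> r * \<beta> * \<epsilon>\<^sup>2" using y \<delta> r \<beta> by (intro mult_left_mono power_mono) auto
        then show ?thesis by (simp add: algebra_simps power_mult_distrib)
      qed
      finally have "exp ((c\<^sup>2 / 2 - r) * d y + c * y)
          \<le> exp (r * \<beta> * \<epsilon>\<^sup>2) * exp (- \<beta> * ((c * y)\<^sup>2 / 2) + c * y)"
        by (simp add: exp_add [symmetric])
      moreover have "g y \<le> (m + \<epsilon>) * y"
        using \<eta>(2)[of y] y \<delta> by (auto simp: algebra_simps abs_le_iff)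
      ultimately have "exp ((c\<^sup>2 / 2 - r) * d y + c * y) * g y
          \<le> exp (r * \<beta> * \<epsilon>\<^sup>2) * exp (- \<beta> * ((c * y)\<^sup>2 / 2) + c * y) * ((m + \<epsilon>) * y)"
        using m \<epsilon> y
        by (intro order_trans[OF mult_left_mono mult_right_mono]) auto
      from mult_left_mono[OF this \<open>c \<ge> 0\<close>] show ?thesis
        by (simp add: weight_def A_def mult_ac)
    qed
    show "\<bar>exp ((c\<^sup>2 / 2 - r) * d y + c * y) * g y\<bar>
        \<le> exp ((c\<^sup>2 - c1\<^sup>2) / 2 * d \<delta> + (c - c1) * b) * \<bar>exp ((c1\<^sup>2 / 2 - r) * d y + c1 * y) * g y\<bar>"
      if "c \<ge> c1" "y \<in> {0<..<b} - {0<..<\<delta>}" for c y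
      using mult_right_mono[OF boundary_kernel_decay[OF d_mono \<delta>(1,4) that(2,1) c1(2)], of "\<bar>g y\<bar>" r]
      by (simp add: abs_mult mult.assoc)
    show "((\<lambda>c. c\<^sup>2 * exp ((c\<^sup>2 - c1\<^sup>2) / 2 * d \<delta> + (c - c1) * b)) \<longlongrightarrow> 0) at_top"
      by (rule boundary_kernel_decay_rate[OF d_neg[OF \<delta>(1,4)]])
  qed (use \<delta> c1 int \<open>e > 0\<close> in auto)
  moreover have "(LBINT z:{0<..}. A * weight \<beta> z) + e / 2 \<le> m * weight_mass \<beta> + e"
    using \<epsilon>(2) by (simp add: A_def weight_mass_def)
  ultimately show ?thesis by (auto elim: eventually_mono)
qed

text \<open>
  The counterpart of \<open>boundary_integral_le\<close>. The discounting term \<open>r \<beta> y\<^sup>2 \<ge> 0\<close> now has the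
  favourable sign, so only the error in \<open>g y \<approx> m y\<close> has to be made small.
\<close>

lemma boundary_integral_ge:
  fixes g d :: "real \<Rightarrow> real"
  assumes int: "\<And>c. c > sqrt (2 * r) \<Longrightarrow>
      set_integrable lborel {0<..<b} (\<lambda>y. exp ((c\<^sup>2 / 2 - r) * d y + c * y) * g y)"
    and r: "r \<ge> 0" and b: "b > 0" and m: "m > 0" and \<beta>: "\<beta> > 0"
    and g: "\<And>\<epsilon>. \<epsilon> > 0 \<Longrightarrow> \<forall>\<^sub>F y in at_right 0. \<bar>g y - m * y\<bar> \<le> \<epsilon> * y"
    and d_mono: "antimono_on {0<..<b} d" and d_neg: "\<And>y. 0 < y \<Longrightarrow> y < b \<Longrightarrow> d y < 0"
    and d: "\<forall>\<^sub>F y in at_right 0. d y \<ge> - \<beta> * y\<^sup>2"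
    and "e > 0"
  shows "\<forall>\<^sub>F c in at_top. c\<^sup>2 * (LBINT y:{0<..<b}. exp ((c\<^sup>2 / 2 - r) * d y + c * y) * g y)
     \<ge> m * weight_mass \<beta> - e"
proof -
  have "((\<lambda>\<epsilon>. (m - \<epsilon>) * weight_mass \<beta>) \<longlongrightarrow> (m - 0) * weight_mass \<beta>) (at_right 0)"
    by (intro tendsto_intros)
  then have "\<forall>\<^sub>F \<epsilon> in at_right 0. m * weight_mass \<beta> - e / 2 < (m - \<epsilon>) * weight_mass \<beta>"
    by (rule order_tendstoD) (use \<open>e > 0\<close> in simp)
  moreover have "\<forall>\<^sub>F \<epsilon> in at_right 0. \<epsilon> < m"
    using m by (auto simp: eventually_at_right_field)
  ultimately have "\<forall>\<^sub>F \<epsilon> in at_right 0. \<epsilon> > 0 \<and> \<epsilon> < m \<and> m * weight_mass \<beta> - e / 2 < (m - \<epsilon>) * weight_mass \<beta>"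
    by (intro eventually_conj eventually_at_right_less)
  then obtain \<epsilon> where \<epsilon>: "\<epsilon> > 0" "\<epsilon> < m" "m * weight_mass \<beta> - e / 2 < (m - \<epsilon>) * weight_mass \<beta>"
    using eventually_happens'[OF trivial_limit_at_right_real] by blast
  obtain \<eta> where \<eta>: "\<eta> > 0"
    "\<And>y. 0 < y \<Longrightarrow> y < \<eta> \<Longrightarrow> \<bar>g y - m * y\<bar> \<le> \<epsilon> * y \<and> d y \<ge> - \<beta> * y\<^sup>2"
    using eventually_conj[OF g[OF \<epsilon>(1)] d] by (auto simp: eventually_at_right_field)
  define \<delta> where "\<delta> = min \<eta> (b / 2)"
  have \<delta>: "0 < \<delta>" "\<delta> \<le> \<eta>" "\<delta> < b"
    using \<eta> b by (auto simp: \<delta>_def)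
  define c1 where "c1 = sqrt (2 * r) + 1"
  have c1: "c1 > sqrt (2 * r)" "c1 > 0" using r by (auto simp: c1_def add_nonneg_pos)
  define A where "A = m - \<epsilon>"
  have "\<forall>\<^sub>F c in at_top. c\<^sup>2 * (LBINT y:{0<..<b}. - (exp ((c\<^sup>2 / 2 - r) * d y + c * y) * g y))
      \<le> (LBINT z:{0<..}. - A * weight \<beta> z) + e / 2"
  proof (rule eventually_scaled_integral_le[where \<delta> = \<delta> and q = c1 and p = "sqrt (2 * r)"
        and \<rho> = "\<lambda>c. exp ((c\<^sup>2 - c1\<^sup>2) / 2 * d \<delta> + (c - c1) * b)"])
    show "set_integrable lborel {0<..} (\<lambda>z. - A * weight \<beta> z)"
      by (intro set_integrable_mult_right weight_integrable \<beta>)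
    show "set_integrable lborel {0<..<b} (\<lambda>y. - (exp ((c\<^sup>2 / 2 - r) * d y + c * y) * g y))"
      if "c > sqrt (2 * r)" for c
      using set_integrable_mult_right[OF int[OF that], of "- 1"] by simp
    show "c * - (exp ((c\<^sup>2 / 2 - r) * d y + c * y) * g y) \<le> - A * weight \<beta> (c * y)"
      if c: "c > sqrt (2 * r)" and y: "0 < y" "y < \<delta>" for c y
    proof -
      have "c \<ge> 0" using c r real_sqrt_ge_zero[of "2 * r"] by linarith
      have "2 * r \<le> c\<^sup>2" using c r \<open>c \<ge> 0\<close> real_le_lsqrt by (intro sqrt_le_D) simp
      have "- \<beta> * ((c * y)\<^sup>2 / 2) \<le> (c\<^sup>2 / 2 - r) * (- \<beta> * y\<^sup>2)"
        using r \<beta> by (simp add: algebra_simps power_mult_distrib)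
      also have "\<dots> \<le> (c\<^sup>2 / 2 - r) * d y"
        using \<eta>(2)[of y] y \<delta> \<open>2 * r \<le> c\<^sup>2\<close> by (intro mult_left_mono) auto
      finally have "exp (- \<beta> * ((c * y)\<^sup>2 / 2) + c * y) \<le> exp ((c\<^sup>2 / 2 - r) * d y + c * y)"
        by simp
      moreover have "A * y \<le> g y"
        using \<eta>(2)[of y] y \<delta> by (auto simp: A_def algebra_simps abs_le_iff)
      ultimately have "exp (- \<beta> * ((c * y)\<^sup>2 / 2) + c * y) * (A * y)
          \<le> exp ((c\<^sup>2 / 2 - r) * d y + c * y) * g y"
        using \<epsilon> y by (intro mult_mono) (auto simp: A_def)
      from mult_left_mono[OF this \<open>c \<ge> 0\<close>] show ?thesis
        by (simp add: weight_def mult_ac)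
    qed
    show "\<bar>- (exp ((c\<^sup>2 / 2 - r) * d y + c * y) * g y)\<bar>
        \<le> exp ((c\<^sup>2 - c1\<^sup>2) / 2 * d \<delta> + (c - c1) * b) * \<bar>- (exp ((c1\<^sup>2 / 2 - r) * d y + c1 * y) * g y)\<bar>"
      if "c \<ge> c1" "y \<in> {0<..<b} - {0<..<\<delta>}" for c y
      using mult_right_mono[OF boundary_kernel_decay[OF d_mono \<delta>(1,3) that(2,1) c1(2)], of "\<bar>g y\<bar>" r]
      by (simp add: abs_mult mult.assoc)
    show "((\<lambda>c. c\<^sup>2 * exp ((c\<^sup>2 - c1\<^sup>2) / 2 * d \<delta> + (c - c1) * b)) \<longlongrightarrow> 0) at_top"
      by (rule boundary_kernel_decay_rate[OF d_neg[OF \<delta>(1,3)]])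
  qed (use \<delta> c1 int \<open>e > 0\<close> in auto)
  moreover have "(LBINT z:{0<..}. - A * weight \<beta> z) = - A * weight_mass \<beta>"
    unfolding weight_mass_def by (rule set_integral_mult_right)
  then have "(LBINT z:{0<..}. - A * weight \<beta> z) + e / 2 \<le> - (m * weight_mass \<beta>) + e"
    using \<epsilon>(3) by (simp add: A_def algebra_simps)
  ultimately show ?thesis
    by (auto elim!: eventually_mono simp: set_lebesgue_integral_def)
qed

section \<open>Numerical enclosure of the constant\<close>

text \<open>
  For \<open>x \<ge> 0\<close> the parity of \<open>n\<close> decides on which side of \<open>exp (- x)\<close> this Taylor polynomial lies.
\<close>

definition exp_minus_poly :: "nat \<Rightarrow> real \<Rightarrow> real" where
  "exp_minus_poly n x = (\<Sum>k<n. (- x) ^ k / fact k)"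

text \<open>
  Integrating the Taylor polynomial of \<open>exp (- B w\<^sup>2 / 2)\<close> term by term over \<open>[0, a]\<close> gives
  \<open>a * gauss_primitive_poly n (B a\<^sup>2 / 2)\<close>: a truncation of the series of the error function.
\<close>

definition gauss_primitive_poly :: "nat \<Rightarrow> real \<Rightarrow> real" where
  "gauss_primitive_poly n x = (\<Sum>k<n. (- x) ^ k / (fact k * (2 * real k + 1)))"

lemma exp_minus_poly_bounds:
  fixes x :: real
  assumes "x \<ge> 0"
  shows "even n \<Longrightarrow> exp_minus_poly n x \<le> exp (- x)"
    and "odd n \<Longrightarrow> exp (- x) \<le> exp_minus_poly n x"
proof -
  obtain t where t: "exp (- x) = exp_minus_poly n x + exp t / fact n * (- x) ^ n"
    using Maclaurin_exp_le[of "- x" n] unfolding exp_minus_poly_def by blast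
  show "exp_minus_poly n x \<le> exp (- x)" if "even n"
    using that t by (simp add: zero_le_even_power)
  show "exp (- x) \<le> exp_minus_poly n x" if "odd n"
    using that t assms by (simp add: power_minus_odd)
qed

lemma gauss_primitive_poly_integral:
  fixes a B :: real
  assumes "a \<ge> 0"
  shows "(LBINT w:{0<..<a}. exp_minus_poly n (B * (w\<^sup>2 / 2))) = a * gauss_primitive_poly n (B * (a\<^sup>2 / 2))"
proof -
  have "(LBINT w=ereal 0..ereal a. exp_minus_poly n (B * (w\<^sup>2 / 2)))
      = a * gauss_primitive_poly n (B * (a\<^sup>2 / 2)) - 0 * gauss_primitive_poly n (B * (0\<^sup>2 / 2))"
  proof (rule interval_integral_FTC_finite)
    show "continuous_on {min 0 a..max 0 a} (\<lambda>w. exp_minus_poly n (B * (w\<^sup>2 / 2)))"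
      unfolding exp_minus_poly_def by (intro continuous_intros) auto
    \<comment> \<open>The integral of \<open>(w\<^sup>2)\<^sup>k\<close> produces the factor \<open>2 k + 1\<close> in the denominators.\<close>
    have deriv_term: "((\<lambda>w. w * ((- (B * (w\<^sup>2 / 2))) ^ k / (fact k * (2 * real k + 1)))) has_real_derivative
        (- (B * (w\<^sup>2 / 2))) ^ k / fact k) (at w)" for k w
    proof -
      have *: "w * ((- (B * (w\<^sup>2 / 2))) ^ k / (fact k * (2 * real k + 1)))
          = (- (B / 2)) ^ k / fact k * (w ^ (2 * k + 1) / (2 * real k + 1))" for w :: real
        by (simp add: power_mult_distrib power_mult power_minus[of "B * w\<^sup>2 / 2"]
            power_minus[of "B / 2"] power_divide mult_ac flip: power_mult)
      have "((\<lambda>w. (- (B / 2)) ^ k / fact k * (w ^ (2 * k + 1) / (2 * real k + 1))) has_real_derivative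
          (- (B / 2)) ^ k / fact k * (real (2 * k + 1) * w ^ (2 * k + 1 - Suc 0) / (2 * real k + 1))) (at w)"
        by (intro DERIV_cmult DERIV_cdivide DERIV_pow)
      also have "real (2 * k + 1) * w ^ (2 * k + 1 - Suc 0) / (2 * real k + 1) = w ^ (2 * k)"
        using of_nat_neq_0[of "2 * k", where ?'a = real] by (simp add: add.commute)
      also have "(- (B / 2)) ^ k / fact k * w ^ (2 * k) = (- (B * (w\<^sup>2 / 2))) ^ k / fact k"
        by (simp add: power_mult_distrib power_mult power_minus[of "B * w\<^sup>2 / 2"]
            power_minus[of "B / 2"] power_divide)
      finally show ?thesis unfolding * .
    qed
    show "((\<lambda>w. w * gauss_primitive_poly n (B * (w\<^sup>2 / 2))) has_vector_derivative
        exp_minus_poly n (B * (w\<^sup>2 / 2))) (at w within {min 0 a..max 0 a})" for w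
      unfolding gauss_primitive_poly_def exp_minus_poly_def sum_distrib_left
        has_real_derivative_iff_has_vector_derivative [symmetric]
      by (intro DERIV_sum DERIV_subset[OF deriv_term]) auto
  qed
  then show ?thesis using assms by (simp add: interval_integral_Ioo)
qed

lemma gauss_integrable:
  assumes "B > 0"
  shows "integrable lborel (\<lambda>w::real. exp (- B * (w\<^sup>2 / 2)))"
proof -
  have "integrable lborel (\<lambda>w. sqrt (2 * pi / B) * normal_density 0 (1 / sqrt B) w)"
    using assms by (intro integrable_mult_right integrable_normal_density) auto
  moreover have "sqrt (2 * pi / B) * normal_density 0 (1 / sqrt B) w = exp (- B * (w\<^sup>2 / 2))" for w
    using assms by (simp add: normal_density_def power_divide real_sqrt_mult real_sqrt_divide)
  ultimately show ?thesis by simp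
qed

lemma gauss_half_integral:
  assumes "B > 0"
  shows "(LBINT w:{0..}. exp (- B * (w\<^sup>2 / 2))) = sqrt (pi / (2 * B))"
proof -
  define s where "s = sqrt (B / 2)"
  have s: "s > 0" "s\<^sup>2 = B / 2" using assms by (auto simp: s_def)
  have "has_bochner_integral lborel
      (\<lambda>w. indicator {0..} (0 + s * w) *\<^sub>R exp (- (0 + s * w)\<^sup>2)) ((sqrt pi / 2) /\<^sub>R \<bar>s\<bar>)"
    using gaussian_moment_0 s by (subst lborel_has_bochner_integral_real_affine_iff [symmetric]) auto
  moreover have "indicator {0..} (0 + s * w) *\<^sub>R exp (- (0 + s * w)\<^sup>2)
      = indicator {0..} w *\<^sub>R exp (- B * (w\<^sup>2 / 2))" for w
    using s by (auto simp: power_mult_distrib zero_le_mult_iff split: split_indicator)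
  moreover have "(sqrt pi / 2) /\<^sub>R \<bar>s\<bar> = sqrt (pi / (2 * B))"
  proof -
    have "sqrt (pi / (2 * B)) = sqrt (pi / (4 * s\<^sup>2))" using s by simp
    also have "\<dots> = sqrt pi / (2 * s)" using s by (simp add: real_sqrt_divide real_sqrt_mult)
    finally show ?thesis using s by (simp add: field_simps)
  qed
  ultimately show ?thesis
    by (simp add: has_bochner_integral_iff set_lebesgue_integral_def)
qed

text \<open>
  Completing the square moves the linear term of the exponent into the shift \<open>w = z - 1 / B\<close>, and the
  integral over \<open>w > - 1 / B\<close> splits at \<open>0\<close>.
\<close>

lemma tilted_gauss_integral:
  assumes "B > 0"
  shows "set_integrable lborel {0<..} (\<lambda>z. exp (- B * (z\<^sup>2 / 2) + z))" (is ?int)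
    and "(LBINT z:{0<..}. exp (- B * (z\<^sup>2 / 2) + z))
      = exp (1 / (2 * B)) * (sqrt (pi / (2 * B)) + (LBINT w:{0<..<1/B}. exp (- B * (w\<^sup>2 / 2))))" (is ?eq)
proof -
  let ?E = "\<lambda>w. exp (- B * (w\<^sup>2 / 2))"
  have E: "set_integrable lborel A ?E" if "A \<in> sets borel" for A
    unfolding set_integrable_def using gauss_integrable[OF assms] that
    by (intro integrable_mult_indicator) auto
  have shift: "exp (- B * (z\<^sup>2 / 2) + z) = exp (1 / (2 * B)) * ?E (- (1 / B) + 1 * z)" for z
    using assms by (simp add: exp_add [symmetric] power2_eq_square field_simps)
  have ind: "indicat_real {0<..} z = indicator {-1/B<..} (- (1 / B) + 1 * z)" for z
    by (auto split: split_indicator)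
  have "integrable lborel (\<lambda>z. indicator {-1/B<..} (- (1 / B) + 1 * z) *\<^sub>R ?E (- (1 / B) + 1 * z))"
    using E[of "{-1/B<..}"] unfolding set_integrable_def
    by (intro lborel_integrable_real_affine) auto
  from integrable_mult_right[OF this, of "exp (1 / (2 * B))"] show ?int
    unfolding set_integrable_def shift ind by (simp add: mult_ac)
  have "(LBINT z:{0<..}. exp (- B * (z\<^sup>2 / 2) + z))
      = exp (1 / (2 * B)) * (LBINT z. indicator {-1/B<..} (- (1 / B) + 1 * z) *\<^sub>R ?E (- (1 / B) + 1 * z))"
    unfolding set_lebesgue_integral_def shift ind
    by (subst integral_mult_right_zero [symmetric]) (simp add: mult_ac)
  also have "(LBINT z. indicator {-1/B<..} (- (1 / B) + 1 * z) *\<^sub>R ?E (- (1 / B) + 1 * z))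
      = (LBINT w:{-1/B<..}. ?E w)"
    unfolding set_lebesgue_integral_def
    by (subst (2) lborel_integral_real_affine[where c = 1 and t = "- (1 / B)"]) auto
  also have "{-1/B<..} = {-1/B<..<0} \<union> {0..}"
    using assms less_le_trans[of "- 1 / B" 0] by auto
  also have "(LBINT w:{-1/B<..<0} \<union> {0..}. ?E w) = (LBINT w:{-1/B<..<0}. ?E w) + (LBINT w:{0..}. ?E w)"
    by (rule set_integral_Un[OF _ E E]) auto
  also have "(LBINT w:{-1/B<..<0}. ?E w) = (LBINT w:{0<..<1/B}. ?E w)"
    by (subst set_integral_reflect) (auto intro!: arg_cong[where f = "\<lambda>S. set_lebesgue_integral lborel S _"])
  finally show ?eq using gauss_half_integral[OF assms] by (simp add: add.commute)
qed

text \<open>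
  \<open>(B z - 1) exp (- B z\<^sup>2 / 2 + z)\<close> is the derivative of \<open>- exp (- B z\<^sup>2 / 2 + z)\<close>, which
  goes from \<open>- 1\<close> at \<open>0\<close> to \<open>0\<close> at infinity.
\<close>

lemma weight_mass_eq:
  assumes "B > 0"
  shows "B * weight_mass B = 1 + (LBINT z:{0<..}. exp (- B * (z\<^sup>2 / 2) + z))"
proof -
  let ?E = "\<lambda>z. exp (- B * (z\<^sup>2 / 2) + z)"
  have int: "set_integrable lborel {0<..} (\<lambda>z. B * weight B z - ?E z)"
    by (intro set_integral_diff set_integrable_mult_right weight_integrable tilted_gauss_integral(1) assms)
  have "(LBINT z=ereal 0..\<infinity>. B * weight B z - ?E z) = 0 - (- 1)"
  proof (rule interval_integral_FTC_integrable[where F = "\<lambda>z. - ?E z"])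
    show "((\<lambda>z. - ?E z) has_vector_derivative B * weight B z - ?E z) (at z)" for z
      unfolding has_real_derivative_iff_has_vector_derivative [symmetric] weight_def
      by (auto intro!: derivative_eq_intros simp: algebra_simps)
    show "isCont (\<lambda>z. B * weight B z - ?E z) z" for z
      unfolding weight_def by (intro continuous_intros) simp_all
    have "isCont (\<lambda>z. - ?E z) 0" by (intro continuous_intros) simp_all
    then have "((\<lambda>z. - ?E z) \<longlongrightarrow> - ?E 0) (at_right 0)"
      by (meson continuous_at_imp_continuous_at_within continuous_within)
    then show "(((\<lambda>z. - ?E z) \<circ> real_of_ereal) \<longlongrightarrow> - 1) (at_right (ereal 0))"
      by (simp add: ereal_tendsto_simps)
    have "((\<lambda>z. - ?E z) \<longlongrightarrow> 0) at_top" using assms by real_asymp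
    then show "(((\<lambda>z. - ?E z) \<circ> real_of_ereal) \<longlongrightarrow> 0) (at_left \<infinity>)"
      by (simp add: ereal_tendsto_simps)
  qed (use int in auto)
  then have "(LBINT z:{0<..}. B * weight B z - ?E z) = 1"
    unfolding interval_integral_to_infinity_eq by simp
  moreover have "(LBINT z:{0<..}. B * weight B z - ?E z) = B * weight_mass B - (LBINT z:{0<..}. ?E z)"
    unfolding weight_mass_def
    by (subst set_integral_diff(2)[OF set_integrable_mult_right[OF weight_integrable[OF assms]]
          tilted_gauss_integral(1)[OF assms]]) simp
  ultimately show ?thesis by simp
qed

text \<open>
  Dividing by \<open>exp (1 / (2 B))\<close> leaves only exponentials of negative arguments in \<open>D\<close>, for which
  \<open>exp_minus_poly_bounds\<close> gives enclosures on both sides.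
\<close>

lemma weight_mass_compare_one:
  assumes "B > 0"
  defines "D \<equiv> sqrt (pi / (2 * B)) + (LBINT w:{0<..<1/B}. exp (- B * (w\<^sup>2 / 2)))
      - (B - 1) * exp (- (1 / (2 * B)))"
  shows "weight_mass B > 1 \<longleftrightarrow> D > 0" and "weight_mass B < 1 \<longleftrightarrow> D < 0"
proof -
  have "exp (1 / (2 * B)) * D = B * (weight_mass B - 1)"
    using weight_mass_eq[OF assms(1)] tilted_gauss_integral(2)[OF assms(1)]
    by (simp add: D_def algebra_simps exp_minus)
  then have D: "weight_mass B - 1 = (exp (1 / (2 * B)) / B) * D"
    using assms(1) by (simp add: field_simps)
  have pos: "exp (1 / (2 * B)) / B > 0" using assms(1) by simp
  show "weight_mass B > 1 \<longleftrightarrow> D > 0"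
    using D zero_less_mult_iff[of "exp (1 / (2 * B)) / B" D] pos by linarith
  show "weight_mass B < 1 \<longleftrightarrow> D < 0"
    using D mult_less_0_iff[of "exp (1 / (2 * B)) / B" D] pos by linarith
qed

lemma gauss_near_zero_bounds:
  assumes "B > 0"
  shows "even n \<Longrightarrow> gauss_primitive_poly n (1 / (2 * B)) / B \<le> (LBINT w:{0<..<1/B}. exp (- B * (w\<^sup>2 / 2)))"
    and "odd n \<Longrightarrow> (LBINT w:{0<..<1/B}. exp (- B * (w\<^sup>2 / 2))) \<le> gauss_primitive_poly n (1 / (2 * B)) / B"
proof -
  have E: "set_integrable lborel {0<..<1/B} (\<lambda>w. exp (- B * (w\<^sup>2 / 2)))"
    unfolding set_integrable_def using gauss_integrable[OF assms]
    by (intro integrable_mult_indicator) auto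
  have P: "set_integrable lborel {0<..<1/B} (\<lambda>w. exp_minus_poly n (B * (w\<^sup>2 / 2)))"
    by (rule set_integrable_subset[OF borel_integrable_atLeastAtMost'[of 0 "1 / B"]])
       (auto simp: exp_minus_poly_def intro!: continuous_intros)
  have Q: "(LBINT w:{0<..<1/B}. exp_minus_poly n (B * (w\<^sup>2 / 2))) = gauss_primitive_poly n (1 / (2 * B)) / B"
    using gauss_primitive_poly_integral[of "1 / B" n B] assms by (simp add: power2_eq_square mult.commute)
  have nn: "B * (w\<^sup>2 / 2) \<ge> 0" for w using assms by simp
  show "gauss_primitive_poly n (1 / (2 * B)) / B \<le> (LBINT w:{0<..<1/B}. exp (- B * (w\<^sup>2 / 2)))" if "even n"
    unfolding Q [symmetric]
    using exp_minus_poly_bounds(1)[OF nn that] by (intro set_integral_mono E P) simp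
  show "(LBINT w:{0<..<1/B}. exp (- B * (w\<^sup>2 / 2))) \<le> gauss_primitive_poly n (1 / (2 * B)) / B" if "odd n"
    unfolding Q [symmetric]
    using exp_minus_poly_bounds(2)[OF nn that] by (intro set_integral_mono E P) simp
qed

text \<open>
  The two endpoints are close to the solution \<open>2.45033\<dots>\<close>, so the difference \<open>D\<close> of
  \<open>weight_mass_compare_one\<close> is only of size \<open>10\<^sup>-\<^sup>4\<close>
  respectively \<open>2 \<cdot> 10\<^sup>-\<^sup>5\<close> there. The numbers of Taylor terms have the parities required by the
  directions of the bounds and are large enough for this accuracy. The rational \<open>0.80066\<close> separates
  the two values of \<open>sqrt (pi / (2 B))\<close>, which are near \<open>0.80067\<close> and \<open>0.800656\<close>.
\<close>

lemma weight_mass_gt_one: "weight_mass 2.45025 > 1"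
proof -
  define B :: real where "B = 2.45025"
  have B: "B > 0" by (simp add: B_def)
  have "0.80066 < sqrt (pi / (2 * B))"
    using pi_approx(1) by (intro real_less_rsqrt) (simp add: B_def power2_eq_square field_simps)
  moreover have "gauss_primitive_poly 4 (1 / (2 * B)) / B \<le> (LBINT w:{0<..<1/B}. exp (- B * (w\<^sup>2 / 2)))"
    by (rule gauss_near_zero_bounds[OF B]) simp
  moreover have "(B - 1) * exp (- (1 / (2 * B))) \<le> (B - 1) * exp_minus_poly 5 (1 / (2 * B))"
    using exp_minus_poly_bounds(2)[of "1 / (2 * B)" 5] by (intro mult_left_mono) (auto simp: B_def)
  moreover have "(B - 1) * exp_minus_poly 5 (1 / (2 * B)) < 0.80066 + gauss_primitive_poly 4 (1 / (2 * B)) / B"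
    by (simp add: B_def exp_minus_poly_def gauss_primitive_poly_def lessThan_nat_numeral lessThan_Suc fact_numeral field_simps)
  ultimately show ?thesis
    unfolding B_def [symmetric] weight_mass_compare_one(1)[OF B] by linarith
qed

lemma weight_mass_less_one: "weight_mass 2.45035 < 1"
proof -
  define B :: real where "B = 2.45035"
  have B: "B > 0" by (simp add: B_def)
  have "sqrt (pi / (2 * B)) < 0.80066"
    using pi_approx(2) by (intro real_less_lsqrt) (simp_all add: B_def power2_eq_square field_simps)
  moreover have "(LBINT w:{0<..<1/B}. exp (- B * (w\<^sup>2 / 2))) \<le> gauss_primitive_poly 5 (1 / (2 * B)) / B"
    by (rule gauss_near_zero_bounds[OF B]) simp
  moreover have "(B - 1) * exp (- (1 / (2 * B))) \<ge> (B - 1) * exp_minus_poly 6 (1 / (2 * B))"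
    using exp_minus_poly_bounds(1)[of "1 / (2 * B)" 6] by (intro mult_left_mono) (auto simp: B_def)
  moreover have "(B - 1) * exp_minus_poly 6 (1 / (2 * B)) > 0.80066 + gauss_primitive_poly 5 (1 / (2 * B)) / B"
    by (simp add: B_def exp_minus_poly_def gauss_primitive_poly_def lessThan_nat_numeral lessThan_Suc fact_numeral field_simps)
  ultimately show ?thesis
    unfolding B_def [symmetric] weight_mass_compare_one(2)[OF B] by linarith
qed

lemma B1_existence:
  obtains B1 where "2.45025 < B1" "B1 < 2.45035" "B1_equation B1"
proof -
  have "\<exists>B\<ge>2.45025. B \<le> 2.45035 \<and> weight_mass B = 1"
    using weight_mass_gt_one weight_mass_less_one
    by (intro IVT2') (auto intro: weight_mass_continuous)
  then obtain B where B: "2.45025 \<le> B" "B \<le> 2.45035" "weight_mass B = 1" by blast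
  have "B \<noteq> 2.45025" using B(3) weight_mass_gt_one by (metis less_irrefl)
  moreover have "B \<noteq> 2.45035" using B(3) weight_mass_less_one by (metis less_irrefl)
  ultimately have "2.45025 < B" "B < 2.45035" using B(1,2) by linarith+
  moreover have "B1_equation B"
    using B by (auto simp: B1_equation_iff intro!: weight_integrable)
  ultimately show ?thesis by (rule that)
qed

lemma weight_mass_sign:
  assumes "B1_equation B1" "B1 > 0"
  shows "B > B1 \<Longrightarrow> weight_mass B < 1" and "0 < B \<Longrightarrow> B < B1 \<Longrightarrow> weight_mass B > 1"
  using assms weight_mass_strict_antimono[of B1 B] weight_mass_strict_antimono[OF weight_integrable, of B B1]
  by (auto simp: B1_equation_iff)

lemma B1_equation_unique:
  assumes "B1_equation B" "B1_equation B'"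
  shows "B = B'"
  using assms weight_mass_strict_antimono[of B B'] weight_mass_strict_antimono[of B' B]
  by (cases B B' rule: linorder_cases) (auto simp: B1_equation_iff)

section \<open>The limit of the ratio\<close>

text \<open>
  The analytic core, for an arbitrary function \<open>g\<close> in the role of \<open>h_tilde\<close>. Both sides of the
  equation, times \<open>c\<^sup>2\<close>, tend to \<open>m\<close>; every quadratic bound on \<open>d\<close> near \<open>0\<close> is tested against that
  limit.
\<close>

lemma boundary_ratio_limit:
  fixes g d :: "real \<Rightarrow> real" and L :: ereal
  assumes r: "r \<ge> 0" and b: "b > 0" and m: "m > 0"
    and g: "(\<lambda>y. g y - m * y) \<in> o[at 0](\<lambda>y. y)"
    and d_mono: "antimono_on {0<..<b} d" and d_neg: "\<And>y. 0 < y \<Longrightarrow> y < b \<Longrightarrow> d y < 0"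
    and int_left: "\<And>c. c > sqrt (2 * r) \<Longrightarrow>
      set_integrable lborel {..<0} (\<lambda>y. exp (c * y) * g y)"
    and int_right: "\<And>c. c > sqrt (2 * r) \<Longrightarrow>
      set_integrable lborel {0<..<b} (\<lambda>y. exp ((c\<^sup>2 / 2 - r) * d y + c * y) * g y)"
    and int_eq: "\<And>c. c > sqrt (2 * r) \<Longrightarrow>
      - (LBINT y:{..<0}. exp (c * y) * g y) =
        (LBINT y:{0<..<b}. exp ((c\<^sup>2 / 2 - r) * d y + c * y) * g y)"
    and lim: "((\<lambda>y. ereal (d y / y\<^sup>2)) \<longlongrightarrow> L) (at_right 0)"
    and B1: "B1_equation B1" "B1 > 0"
  shows "L = ereal (- B1)"
proof -
  let ?R = "\<lambda>c. LBINT y:{0<..<b}. exp ((c\<^sup>2 / 2 - r) * d y + c * y) * g y"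
  have g_abs: "\<forall>\<^sub>F y in at 0. \<bar>g y - m * y\<bar> \<le> \<epsilon> * \<bar>y\<bar>" if "\<epsilon> > 0" for \<epsilon>
    using landau_o.smallD[OF g that] by simp
  have g_right: "\<forall>\<^sub>F y in at_right 0. \<bar>g y - m * y\<bar> \<le> \<epsilon> * y" if "\<epsilon> > 0" for \<epsilon>
    using g_abs[OF that] unfolding at_eq_sup_left_right eventually_sup
    by (auto elim!: eventually_mono[OF eventually_conj[OF _ eventually_at_right_less[of 0]]])
  have g_left: "\<forall>\<^sub>F y in at_right 0. \<bar>- g (- y) - m * y\<bar> \<le> \<epsilon> * y" if "\<epsilon> > 0" for \<epsilon>
  proof -
    have "\<forall>\<^sub>F y in at_left 0. \<bar>g y - m * y\<bar> \<le> \<epsilon> * \<bar>y\<bar>"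
      using g_abs[OF that] unfolding at_eq_sup_left_right eventually_sup by blast
    then have "\<forall>\<^sub>F y in at_right 0. \<bar>g (- y) - m * - y\<bar> \<le> \<epsilon> * \<bar>- y\<bar>"
      by (simp add: eventually_at_left_to_right)
    then show ?thesis
      using eventually_at_right_less[of "0::real"] by eventually_elim (simp add: abs_le_iff)
  qed
  have reflect: "{y::real. - y \<in> {..<0}} = {0<..}" by auto
  have left_int: "set_integrable lborel {0<..} (\<lambda>y. exp (- c * y) * - g (- y))" if "c > sqrt (2 * r)" for c
  proof -
    have "integrable lborel (\<lambda>y. indicator {..<0} (0 + -1 * y) *\<^sub>R (exp (c * (0 + -1 * y)) * g (0 + -1 * y)))"
      using int_left[OF that] unfolding set_integrable_def by (intro lborel_integrable_real_affine) auto
    from integrable_minus[OF this] show ?thesis unfolding set_integrable_def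
      by (rule Bochner_Integration.integrable_cong[THEN iffD1, rotated 2]) (auto split: split_indicator)
  qed
  have left_eq: "?R c = (LBINT y:{0<..}. exp (- c * y) * - g (- y))" if "c > sqrt (2 * r)" for c
    unfolding int_eq[OF that, symmetric]
    by (subst set_integral_reflect, subst reflect) (simp add: set_lebesgue_integral_def)
  have "((\<lambda>c. c\<^sup>2 * (LBINT y:{0<..}. exp (- c * y) * - g (- y))) \<longlongrightarrow> m) at_top"
    by (rule laplace_transform_linear_at_zero[where ?c0.0 = "sqrt (2 * r)", OF left_int]) (use r g_left in auto)
  then have R_lim: "((\<lambda>c. c\<^sup>2 * ?R c) \<longlongrightarrow> m) at_top"
    by (rule Lim_transform_eventually)
       (use eventually_gt_at_top[of "sqrt (2 * r)"] in \<open>eventually_elim, simp only: left_eq\<close>)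
  have upper: "weight_mass \<beta> \<ge> 1" if "\<beta> > 0" "\<forall>\<^sub>F y in at_right 0. d y \<le> - \<beta> * y\<^sup>2" for \<beta>
  proof -
    have "m \<le> m * weight_mass \<beta> + e" if "e > 0" for e
      by (rule tendsto_upperbound[OF R_lim
            boundary_integral_le[OF int_right r b m \<open>\<beta> > 0\<close> g_right d_mono d_neg \<open>eventually _ _\<close> that]]) auto
    then have "m \<le> m * weight_mass \<beta>" by (rule field_le_epsilon)
    then show ?thesis using m by simp
  qed
  have lower: "weight_mass \<beta> \<le> 1" if "\<beta> > 0" "\<forall>\<^sub>F y in at_right 0. d y \<ge> - \<beta> * y\<^sup>2" for \<beta>
  proof -
    have "m * weight_mass \<beta> \<le> m + e" if "e > 0" for e
      using tendsto_lowerbound[OF R_lim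
            boundary_integral_ge[OF int_right r b m \<open>\<beta> > 0\<close> g_right d_mono d_neg \<open>eventually _ _\<close> that]] by auto
    then have "m * weight_mass \<beta> \<le> m" by (rule field_le_epsilon)
    then show ?thesis using m by simp
  qed
  show ?thesis
  proof (cases L "ereal (- B1)" rule: linorder_cases)
    case less
    then obtain \<gamma> where \<gamma>: "L < ereal \<gamma>" "\<gamma> < - B1"
      using ereal_dense3 ereal_dense2 by (metis less_ereal.simps(1))
    have "\<forall>\<^sub>F y in at_right 0. ereal (d y / y\<^sup>2) < ereal \<gamma>"
      using order_tendstoD(2)[OF lim \<gamma>(1)] .
    then have "\<forall>\<^sub>F y in at_right 0. d y \<le> - (- \<gamma>) * y\<^sup>2"
      using eventually_at_right_less[of "0::real"] by eventually_elim (simp add: divide_less_eq)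
    then have "weight_mass (- \<gamma>) \<ge> 1" using \<gamma> B1 by (intro upper) auto
    with weight_mass_sign(1)[OF B1, of "- \<gamma>"] \<gamma> show ?thesis by auto
  next
    case greater
    then obtain \<kappa> where \<kappa>: "- B1 < \<kappa>" "ereal \<kappa> < L"
      using ereal_dense2 by (metis less_ereal.simps(1))
    \<comment> \<open>The minimum ensures that \<open>- \<gamma>\<close> is positive, as the lower bound on the integral requires.\<close>
    define \<gamma> where "\<gamma> = min \<kappa> (- B1 / 2)"
    have \<gamma>: "- B1 < \<gamma>" "\<gamma> < 0" "ereal \<gamma> < L"
      using \<kappa> B1(2) by (auto simp: \<gamma>_def min_def intro: le_less_trans[of _ "ereal \<kappa>"])
    have "\<forall>\<^sub>F y in at_right 0. ereal (d y / y\<^sup>2) > ereal \<gamma>"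
      using order_tendstoD(1)[OF lim \<gamma>(3)] .
    then have "\<forall>\<^sub>F y in at_right 0. d y \<ge> - (- \<gamma>) * y\<^sup>2"
      using eventually_at_right_less[of "0::real"] by eventually_elim (simp add: less_divide_eq)
    then have "weight_mass (- \<gamma>) \<le> 1" using \<gamma> by (intro lower) auto
    with weight_mass_sign(2)[OF B1, of "- \<gamma>"] \<gamma> show ?thesis by auto
  qed auto
qed

theorem theorem3p3:
  fixes P :: "real \<Rightarrow> real \<Rightarrow> 'a measure"
    and F :: "real \<Rightarrow> 'a measure"
    and W :: "real \<Rightarrow> 'a \<Rightarrow> real"
    and r :: real and h :: "real \<Rightarrow> real"
    and C :: "(real \<times> real) set"
    and b d :: "real \<Rightarrow> real" and b_inf m :: real
  assumes BM: "\<And>t x. t \<le> 0 \<Longrightarrow> brownian_motion_from (P t x) F W t x"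
    and r: "r \<ge> 0"
    and h: "C2 h"
    and C: "C = continuation_set P F W r h"
    and one_sided: "\<And>t. t < 0 \<Longrightarrow> {x. (t, x) \<in> C} = {..<b t}"
    and b_mono: "antimono_on {..<0} b"
    and b_lim: "(b \<longlongrightarrow> b_inf) at_bot"
    and b_inf: "b_inf > 0"
    and C_0: "{x. (0, x) \<in> C} = {..<0}"
    and m: "m > 0"
    and h_tilde_0: "(\<lambda>x. h_tilde r h x - m * x) \<in> o[at 0](\<lambda>x. x)"
    and d: "d = exit_time C"
    and d_mono: "antimono_on {0..<b_inf} d"
    and d_0: "d 0 = 0"
    and d_neg: "\<And>x. 0 < x \<Longrightarrow> x < b_inf \<Longrightarrow> d x < 0"
    and int_left: "\<And>c. c > sqrt (2 * r) \<Longrightarrow>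
      set_integrable lborel {..<0} (\<lambda>y. exp (c * y) * h_tilde r h y)"
    and int_right: "\<And>c. c > sqrt (2 * r) \<Longrightarrow>
      set_integrable lborel {0..<b_inf} (\<lambda>y. exp ((c\<^sup>2 / 2 - r) * d y + c * y) * h_tilde r h y)"
    and int_eq: "\<And>c. c > sqrt (2 * r) \<Longrightarrow>
      - (LBINT y:{..<0}. exp (c * y) * h_tilde r h y) =
        (LBINT y:{0..<b_inf}. exp ((c\<^sup>2 / 2 - r) * d y + c * y) * h_tilde r h y)"
    and lim_ex: "\<exists>L::ereal. ((\<lambda>x. ereal (d x / x\<^sup>2)) \<longlongrightarrow> L) (at_right 0)"
  shows "\<exists>B1. B1_equation B1 \<and> (\<forall>B. B1_equation B \<longrightarrow> B = B1) \<and>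
      \<bar>B1 - 2.4503\<bar> < 0.00005 \<and>
      ((\<lambda>x. d x / x\<^sup>2) \<longlongrightarrow> - B1) (at_right 0) \<and>
      (\<lambda>x. d x - (- B1 * x\<^sup>2)) \<in> o[at_right 0](\<lambda>x. x\<^sup>2)"
proof -
  obtain B1 where B1: "2.45025 < B1" "B1 < 2.45035" "B1_equation B1"
    by (rule B1_existence)
  obtain L :: ereal where L: "((\<lambda>x. ereal (d x / x\<^sup>2)) \<longlongrightarrow> L) (at_right 0)"
    using lim_ex by blast
  have null: "set_lebesgue_integral lborel {0..<b_inf} f = set_lebesgue_integral lborel {0<..<b_inf} f"
    for f :: "real \<Rightarrow> real"
    by (rule set_integral_discrete_difference[where X = "{0}"]) auto
  have "L = ereal (- B1)"
  proof (rule boundary_ratio_limit[OF r b_inf m h_tilde_0 _ d_neg int_left _ _ L B1(3)])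
    show "antimono_on {0<..<b_inf} d"
      using d_mono by (rule monotone_on_subset) auto
    show "set_integrable lborel {0<..<b_inf} (\<lambda>y. exp ((c\<^sup>2 / 2 - r) * d y + c * y) * h_tilde r h y)"
      if "c > sqrt (2 * r)" for c
      by (rule set_integrable_subset[OF int_right[OF that]]) auto
  qed (use int_eq B1 in \<open>auto simp: null\<close>)
  with L have lim: "((\<lambda>x. d x / x\<^sup>2) \<longlongrightarrow> - B1) (at_right 0)" by simp
  have "((\<lambda>x. d x / x\<^sup>2 - - B1) \<longlongrightarrow> - B1 - - B1) (at_right 0)"
    by (intro tendsto_diff lim tendsto_const)
  then have "((\<lambda>x. d x / x\<^sup>2 - - B1) \<longlongrightarrow> 0) (at_right 0)" by simp
  then have "((\<lambda>x. (d x - (- B1 * x\<^sup>2)) / x\<^sup>2) \<longlongrightarrow> 0) (at_right 0)"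
    by (rule Lim_transform_eventually[OF _ eventually_mono[OF eventually_at_right_less]])
       (auto simp: field_simps)
  then have "(\<lambda>x. d x - (- B1 * x\<^sup>2)) \<in> o[at_right 0](\<lambda>x. x\<^sup>2)"
    by (rule smalloI_tendsto) (auto simp: eventually_at_filter)
  moreover have "\<bar>B1 - 2.4503\<bar> < 0.00005"
    unfolding abs_less_iff using B1(1,2) by simp
  ultimately show ?thesis using B1(3) lim B1_equation_unique by blast
qed

end
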